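(* Let $m$ be a non-negative integer. For $z\in\mathbb{C}$ with $|z|<1$, $$P_m^2(1-2z)=F^2(-m,m+1;1;z)=\sum_{n=0}^\infty u_n z^n,$$ where $u_0=1$, $u_1=-2m(m+1)$ and $$u_{n+1}=\frac{(2n+1)\left(-2m(m+1)+n^2+n\right)}{(n+1)^3}u_n+\frac{(2m+1)^2n-n^3}{(n+1)^3}u_{n-1},\qquad n\ge 1.$$
   Context: $P_m$ is the Legendre polynomial of degree $m$, normalized by $P_m(1)=1$. $F(a,b;c;z)=\sum_{k=0}^\infty \frac{(a)_k(b)_k}{(c)_k\,k!}z^k$, $|z|<1$, is the Gaussian hypergeometric function, with $(x)_k=x(x+1)\cdots(x+k-1)$, $(x)_0=1$. Superscript $2$ on a function denotes its square. *)

theory Defs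
  imports "HOL-Analysis.Analysis" "HOL-Computational_Algebra.Computational_Algebra"
begin

text \<open>Rodrigues' formula
  \<open>P\<^sub>m(x) = 1 / (2\<^sup>m m!) (d/dx)\<^sup>m (x\<^sup>2 - 1)\<^sup>m\<close>, with formal differentiation.\<close>

definition legendre_poly :: "nat \<Rightarrow> 'a :: field_char_0 poly" where
  "legendre_poly m = smult (1 / (2 ^ m * fact m)) ((pderiv ^^ m) ([:-1, 0, 1:] ^ m))"

lemma degree_funpow_pderiv:
  "degree ((pderiv ^^ k) (p :: 'a :: field_char_0 poly)) = degree p - k"
  by (induction k) (auto simp: degree_pderiv)

lemma poly_funpow_pderiv_linear_power:
  "poly ((pderiv ^^ m) ([:-c, 1:] ^ m * q)) c = fact m * poly q (c :: 'a :: field_char_0)"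
proof (induction m arbitrary: q)
  case (Suc m)
  have "pderiv ([:-c, 1:] ^ Suc m * q) =
        [:-c, 1:] ^ m * (smult (of_nat (Suc m)) q + [:-c, 1:] * pderiv q)"
    by (simp only: pderiv_mult pderiv_power_Suc) (simp add: pderiv_pCons algebra_simps)
  then show ?case
    using Suc[of "smult (of_nat (Suc m)) q + [:-c, 1:] * pderiv q"]
    by (simp only: funpow_Suc_right o_apply) (simp add: algebra_simps)
qed simp

lemma degree_legendre_poly: "degree (legendre_poly m :: 'a :: field_char_0 poly) = m"
  by (simp add: legendre_poly_def degree_funpow_pderiv degree_power_eq)

lemma poly_legendre_poly_1: "poly (legendre_poly m) (1 :: 'a :: field_char_0) = 1"
proof -
  have "[:-1, 0, 1:] ^ m = [:-1, 1:] ^ m * [:1, 1 :: 'a:] ^ m"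
    by (simp flip: power_mult_distrib)
  then show ?thesis
    using poly_funpow_pderiv_linear_power[of m "1 :: 'a" "[:1, 1:] ^ m"]
    by (simp add: legendre_poly_def)
qed

definition hypergeo_2F1 :: "complex \<Rightarrow> complex \<Rightarrow> complex \<Rightarrow> complex \<Rightarrow> complex" where
  "hypergeo_2F1 a b c z = eval_fps (fps_hypergeo [a, b] [c] 1) z"

lemma hypergeo_2F1_altdef:
  "hypergeo_2F1 a b c z =
     (\<Sum>k. pochhammer a k * pochhammer b k / (pochhammer c k * fact k) * z ^ k)"
  by (simp add: hypergeo_2F1_def eval_fps_def fps_hypergeo_def)

end

theory Submission
  imports Defs
begin

text \<open>
  The polynomial \<open>y(z) = P\<^sub>m(1 - 2z)\<close> is the power series solution, normalised by \<open>y(0) = 1\<close>, of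
  Legendre's equation \<open>(z(1 - z)y')' + m(m + 1)y = 0\<close>. Everything is done with formal power
  series and the Euler operator \<open>\<theta> = z d/dz\<close> (\<^const>\<open>fps_XD\<close>), for which the equation reads
  \<open>\<theta>((1 - z)\<theta>y) = -m(m + 1)zy\<close>. Since \<open>\<theta>\<close> multiplies the coefficient of \<open>z\<^sup>n\<close> by \<open>n\<close>, this is
  a two-term recurrence for the coefficients. It determines them from \<open>y(0)\<close> and is satisfied by
  the coefficients of \<open>F(-m, m + 1; 1; z)\<close>, so the two functions agree
  (\<open>fps_hypergeo_eq_shifted_legendre\<close>).

  The square of a solution of a second-order linear equation solves a third-order one, here
  \<open>\<theta>((1 - z)\<theta>((1 - z)\<theta>w)) = -2m(m + 1)(z(1 - z)\<theta>w + \<theta>(z(1 - z)w))\<close>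
  (\<open>square_legendre_equation\<close>). Each side shifts coefficients by at most two places, so
  this is the three-term recurrence for \<open>u\<close>, because \<open>4m(m + 1) + 1 = (2m + 1)\<^sup>2\<close>. As
  \<open>w = y\<^sup>2\<close> is a polynomial, its expansion converges everywhere.
\<close>

unbundle no vec_syntax

section \<open>Legendre's differential equation\<close>

text \<open>
  \<open>h = (x\<^sup>2 - 1)\<^sup>m\<close> satisfies \<open>(x\<^sup>2 - 1)h' = 2mxh\<close>; differentiating this \<open>k + 1\<close> times gives the
  equation below, one differentiation per induction step. For \<open>k = m\<close> it becomes Legendre's
  equation.
\<close>

lemma iterated_pderiv_equation:
  fixes m :: nat
  defines "D \<equiv> \<lambda>k. (pderiv ^^ k) ([:-1, 0, 1 :: 'a :: field_char_0:] ^ m)"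
  shows "[:-1, 0, 1:] * D (k + 2) + 2 * (of_nat k + 1 - of_nat m) * [:0, 1:] * D (k + 1)
           + (of_nat k + 1) * (of_nat k - 2 * of_nat m) * D k = 0"
proof -
  define p :: "'a poly" where "p = [:-1, 0, 1:]"
  define x :: "'a poly" where "x = [:0, 1:]"
  have D_Suc: "D (Suc j) = pderiv (D j)" for j
    by (simp add: D_def)
  have p': "pderiv p = 2 * x" and x': "pderiv x = 1"
    by (simp_all add: p_def x_def pderiv_pCons numeral_poly one_pCons)
  have "p * D (k + 2) + 2 * (of_nat k + 1 - of_nat m) * x * D (k + 1)
           + (of_nat k + 1) * (of_nat k - 2 * of_nat m) * D k = 0"
  proof (induction k)
    case 0
    have smult_of_nat: "smult (of_nat n) q = of_nat n * q" for n and q :: "'a poly"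
      by (simp add: of_nat_poly)
    \<comment> \<open>the first-order equation \<open>(x\<^sup>2 - 1)h' = 2mxh\<close>, before any further differentiation\<close>
    have "p * pderiv (p ^ m) = 2 * of_nat m * x * p ^ m"
      by (cases m)
         (simp_all only: pderiv_power_Suc p' smult_of_nat, simp_all add: mult_ac)
    then have "p * D 1 = 2 * of_nat m * x * D 0"
      by (simp add: D_def p_def)
    then have "pderiv (p * D 1) = pderiv (2 * of_nat m * x * D 0)"
      by simp
    then show ?case
      by (simp add: pderiv_mult p' x' D_Suc algebra_simps numeral_2_eq_2)
  next
    case (Suc k)
    then have "pderiv (p * D (k + 2) + 2 * (of_nat k + 1 - of_nat m) * x * D (k + 1)
           + (of_nat k + 1) * (of_nat k - 2 * of_nat m) * D k) = 0"
      by simp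
    then show ?case
      by (simp add: pderiv_mult pderiv_add pderiv_diff p' x' D_Suc algebra_simps numeral_2_eq_2)
  qed
  then show ?thesis
    by (simp only: p_def x_def)
qed

lemma legendre_poly_equation:
  fixes m :: nat
  defines "P \<equiv> legendre_poly m :: 'a :: field_char_0 poly"
  shows "[:-1, 0, 1:] * pderiv (pderiv P) + 2 * [:0, 1:] * pderiv P
           = of_nat m * (of_nat m + 1) * P"
proof -
  define D where "D k = (pderiv ^^ k) ([:-1, 0, 1 :: 'a:] ^ m)" for k
  define c :: 'a where "c = 1 / (2 ^ m * fact m)"
  have P: "P = smult c (D m)" "pderiv P = smult c (D (m + 1))"
    "pderiv (pderiv P) = smult c (D (m + 2))"
    by (simp_all add: P_def legendre_poly_def D_def c_def pderiv_smult)
  have "[:-1, 0, 1:] * D (m + 2) + 2 * [:0, 1:] * D (m + 1) = of_nat m * (of_nat m + 1) * D m"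
    using iterated_pderiv_equation[of m m, where 'a = 'a] unfolding D_def[symmetric]
    by (simp add: algebra_simps)
  then have "smult c ([:-1, 0, 1:] * D (m + 2) + 2 * [:0, 1:] * D (m + 1))
      = smult c (of_nat m * (of_nat m + 1) * D m)"
    by (rule arg_cong)
  then show ?thesis
    unfolding P(3) unfolding P(2) unfolding P(1) by (simp only: smult_add_right mult_smult_right)
qed

lemma fps_XD_mult:
  "fps_XD (f * g) = fps_XD f * g + f * fps_XD (g :: 'a :: comm_ring_1 fps)"
  by (simp add: fps_XD_def algebra_simps)

text \<open>
  Under \<open>x = 1 - 2z\<close> the singular points \<open>1\<close> and \<open>-1\<close> move to \<open>0\<close> and \<open>1\<close>, and \<open>x\<^sup>2 - 1\<close> becomes
  \<open>-4z(1 - z)\<close>. Multiplying the resulting equation by \<open>z\<close> turns \<open>z d/dz (z(1 - z)y')\<close> into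
  \<open>\<theta>((1 - z)\<theta>y)\<close>.
\<close>

lemma shifted_legendre_equation:
  fixes m :: nat
  defines "y \<equiv> fps_of_poly (pcompose (legendre_poly m) [:1, -2 :: 'a :: field_char_0:])"
  shows "fps_XD ((1 - fps_X) * fps_XD y) = - of_nat m * (of_nat m + 1) * fps_X * y"
proof -
  let ?P = "legendre_poly m :: 'a poly" and ?q = "[:1, -2:] :: 'a poly"
  let ?N = "of_nat m * (of_nat m + 1)"
  define Q where "Q = pcompose ?P ?q"
  have q': "pderiv ?q = -2"
    by (simp add: pderiv_pCons numeral_poly)
  have Q': "pderiv Q = -2 * pcompose (pderiv ?P) ?q"
    by (simp add: Q_def pderiv_pcompose q')
  then have Q'': "pderiv (pderiv Q) = 4 * pcompose (pderiv (pderiv ?P)) ?q"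
    by (simp add: pderiv_mult pderiv_minus pderiv_pcompose q')
  have const: "pcompose (of_nat n) ?q = of_nat n" for n
    by (simp add: of_nat_poly)
  have const2: "pcompose 2 ?q = 2"
    by (simp add: numeral_poly)
  have quad: "pcompose [:-1, 0, 1:] ?q = [:0, -4, 4:]"
    by (simp add: pcompose_pCons)
  have lin: "pcompose [:0, 1:] ?q = ?q"
    by (simp add: pcompose_pCons)
  have "pcompose ([:-1, 0, 1:] * pderiv (pderiv ?P) + 2 * [:0, 1:] * pderiv ?P) ?q
      = pcompose (?N * ?P) ?q"
    by (simp only: legendre_poly_equation)
  then have "[:0, -4, 4:] * pcompose (pderiv (pderiv ?P)) ?q + 2 * ?q * pcompose (pderiv ?P) ?q
      = ?N * Q"
    by (simp only: pcompose_add pcompose_mult const const2 quad lin Q_def pcompose_1)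
  moreover have "[:0, -4, 4:] = 4 * [:0, -1, 1 :: 'a:]"
    by (simp add: numeral_poly)
  moreover have "a * (4 * b) - c * (-2 * d) = (4 * a) * b + 2 * c * d" for a b c d :: "'a poly"
    by (simp add: algebra_simps)
  ultimately have "[:0, -1, 1:] * pderiv (pderiv Q) - ?q * pderiv Q = ?N * Q"
    unfolding Q'' unfolding Q' by (simp only:)
  then have "fps_of_poly ([:0, -1, 1:] * pderiv (pderiv Q) - ?q * pderiv Q) = fps_of_poly (?N * Q)"
    by (rule arg_cong)
  moreover have "fps_of_poly [:0, -1, 1 :: 'a:] = - fps_X * (1 - fps_X)"
    by (simp add: fps_of_poly_pCons algebra_simps)
  moreover have "fps_of_poly ?q = 1 - 2 * fps_X"
    by (simp add: fps_of_poly_pCons algebra_simps fps_numeral_fps_const)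
  moreover have "fps_of_poly (of_nat m :: 'a poly) = of_nat m"
    by (simp add: of_nat_poly fps_of_poly_const fps_of_nat)
  ultimately have eq: "- fps_X * (1 - fps_X) * fps_deriv (fps_deriv y)
      - (1 - 2 * fps_X) * fps_deriv y = of_nat m * (of_nat m + 1) * y"
    unfolding y_def Q_def[symmetric]
    by (simp add: fps_of_poly_mult fps_of_poly_add fps_of_poly_diff fps_of_poly_pderiv
        del: mult_pCons_left)
  have "fps_XD ((1 - fps_X) * fps_XD y) = fps_X *
      (fps_X * (1 - fps_X) * fps_deriv (fps_deriv y) + (1 - 2 * fps_X) * fps_deriv y)"
    by (simp add: fps_XD_def algebra_simps)
  also have "\<dots> = - fps_X * (of_nat m * (of_nat m + 1) * y)"
    unfolding eq[symmetric] by (simp add: algebra_simps)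
  finally show ?thesis
    by (simp add: algebra_simps)
qed

section \<open>Identification with the hypergeometric series\<close>

lemma fps_mult_one_minus_X_nth_Suc:
  "((1 - fps_X) * f) $ Suc n = f $ Suc n - (f :: 'a :: comm_ring_1 fps) $ n"
  by (simp add: algebra_simps)

text \<open>
  In coefficients, Legendre's equation is \<open>(n + 1)\<^sup>2 y\<^sub>n\<^sub>+\<^sub>1 = (n(n + 1) - m(m + 1)) y\<^sub>n\<close>, and
  \<open>n(n + 1) - m(m + 1) = (n - m)(n + m + 1)\<close> is the factor by which the Pochhammer symbols of
  the hypergeometric coefficient grow.
\<close>

lemma fps_hypergeo_eq_shifted_legendre:
  "fps_hypergeo [- of_nat m, of_nat m + 1] [1] (1 :: 'a :: field_char_0)
     = fps_of_poly (pcompose (legendre_poly m) [:1, -2:])" (is "?F = ?y")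
proof (rule fps_ext)
  fix n
  show "?F $ n = ?y $ n"
  proof (induction n)
    case 0
    have "?y $ 0 = poly (legendre_poly m) 1"
      by (simp add: poly_pcompose flip: poly_0_coeff_0)
    then show ?case
      by (simp add: poly_legendre_poly_1)
  next
    case (Suc n)
    have N: "of_nat m * (of_nat m + 1) = fps_const (of_nat m * (of_nat m + 1) :: 'a)"
      by (simp add: fps_of_nat flip: fps_const_mult fps_const_add)
    have nz: "of_nat n + (1 :: 'a) \<noteq> 0"
      using of_nat_neq_0[of n, where 'a = 'a] by (simp add: add.commute)
    have "fps_XD ((1 - fps_X) * fps_XD ?y) $ Suc n
        = (- fps_const (of_nat m * (of_nat m + 1)) * (fps_X * ?y)) $ Suc n"
      by (simp only: shifted_legendre_equation N[symmetric] mult_minus_left mult.assoc)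
    then have "(of_nat n + 1) * ((of_nat n + 1) * ?y $ Suc n - of_nat n * ?y $ n)
        = - (of_nat m * (of_nat m + 1)) * ?y $ n"
      by (simp add: fps_mult_one_minus_X_nth_Suc add.commute del: fps_of_poly_nth fps_XD_Suc
          fps_const_mult fps_const_neg fps_const_add)
    then have "(of_nat n + 1) ^ 2 * ?y $ Suc n
        = (of_nat n - of_nat m) * (of_nat n + of_nat m + 1) * ?y $ n"
      by (simp add: algebra_simps power2_eq_square del: fps_of_poly_nth)
    moreover have "(of_nat n + 1) ^ 2 * ?F $ Suc n
        = (of_nat n - of_nat m) * (of_nat n + of_nat m + 1) * ?F $ n"
    proof -
      have "?F $ Suc n = (of_nat n - of_nat m) * (of_nat n + of_nat m + 1) / (of_nat n + 1) ^ 2 * ?F $ n"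
        unfolding fps_hypergeo_rec by (simp add: power2_eq_square add_ac del: fps_hypergeo_nth)
      then show ?thesis
        using nz by (simp del: fps_hypergeo_nth)
    qed
    ultimately have "(of_nat n + 1) ^ 2 * ?F $ Suc n = (of_nat n + 1) ^ 2 * ?y $ Suc n"
      by (simp only: Suc.IH)
    then show ?case
      using nz by (simp del: fps_of_poly_nth fps_hypergeo_nth)
  qed
qed

section \<open>The square of a solution\<close>

text \<open>
  The condition \<open>\<theta>N = 0\<close> makes \<open>N\<close> a constant.
  With \<open>v = (1 - z)\<theta>y\<close> the equation for \<open>y\<close> is the first-order system
  \<open>(1 - z)\<theta>y = v\<close>, \<open>\<theta>v = -Nzy\<close>. Hence \<open>(1 - z)\<theta>w = 2yv\<close>, and applying \<open>(1 - z)\<theta>\<close> again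
  gives \<open>2v\<^sup>2 - 2Nz(1 - z)w\<close>. One more \<open>\<theta>\<close> turns \<open>2v\<^sup>2\<close> into \<open>-4Nzyv = -2Nz(1 - z)\<theta>w\<close>, so that
  \<open>y\<close> and \<open>v\<close> disappear and an equation for \<open>w\<close> alone remains.
\<close>

lemma square_legendre_equation:
  fixes y N :: "'a :: comm_ring_1 fps"
  assumes y: "fps_XD ((1 - fps_X) * fps_XD y) = - N * fps_X * y" and N: "fps_XD N = 0"
  defines "w \<equiv> y ^ 2"
  shows "fps_XD ((1 - fps_X) * fps_XD ((1 - fps_X) * fps_XD w))
           = - 2 * N * (fps_X * ((1 - fps_X) * fps_XD w) + fps_XD (fps_X * ((1 - fps_X) * w)))"
proof -
  define v where "v = (1 - fps_X) * fps_XD y"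
  have v': "fps_XD v = - N * fps_X * y"
    using y by (simp add: v_def)
  have w': "(1 - fps_X) * fps_XD w = 2 * (y * v)"
    by (simp add: w_def v_def power2_eq_square fps_XD_mult algebra_simps)
  have two: "fps_XD (2 * f) = 2 * fps_XD f" for f :: "'a fps"
    by (simp only: mult_2 fps_XD_add)
  have minus: "fps_XD (f - g) = fps_XD f - fps_XD g" for f g :: "'a fps"
    by (simp add: fps_XD_def algebra_simps)
  have collect: "2 * ((- N * x * y) * v + v * (- N * x * y)) - 2 * (0 * a + N * b)
      = - 2 * N * (x * (2 * (y * v)) + b)" for x a b :: "'a fps"
    by (simp add: algebra_simps)
  have expand: "(1 - x) * (2 * (d * ((1 - x) * d) + y * (- N * x * y)))
      = 2 * ((1 - x) * d * ((1 - x) * d)) - 2 * (N * (x * ((1 - x) * (y * y))))" for x d :: "'a fps"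
    by (simp add: algebra_simps)
  have "(1 - fps_X) * fps_XD ((1 - fps_X) * fps_XD w)
      = (1 - fps_X) * (2 * (fps_XD y * v + y * (- N * fps_X * y)))"
    by (simp only: w' two fps_XD_mult[of y v] v')
  also have "\<dots> = 2 * (v * v) - 2 * (N * (fps_X * ((1 - fps_X) * w)))"
    unfolding v_def w_def power2_eq_square by (rule expand)
  finally have "fps_XD ((1 - fps_X) * fps_XD ((1 - fps_X) * fps_XD w))
      = fps_XD (2 * (v * v) - 2 * (N * (fps_X * ((1 - fps_X) * w))))"
    by (rule arg_cong)
  also have "\<dots> = 2 * ((- N * fps_X * y) * v + v * (- N * fps_X * y))
      - 2 * (0 * (fps_X * ((1 - fps_X) * w)) + N * fps_XD (fps_X * ((1 - fps_X) * w)))"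
    by (simp only: minus two fps_XD_mult[of N] fps_XD_mult[of v] v' N)
  also have "\<dots> = - 2 * N * (fps_X * (2 * (y * v)) + fps_XD (fps_X * ((1 - fps_X) * w)))"
    by (rule collect)
  finally show ?thesis
    by (simp only: w')
qed

text \<open>
  The coefficient of \<open>z\<^sup>n\<^sup>+\<^sup>2\<close> in the equation for the square. Starting the index at \<open>n + 2\<close>
  keeps the recurrence free of truncated subtraction; the coefficient of \<open>z\<close> gives the initial
  step.
\<close>

lemma square_legendre_recurrence:
  fixes y :: "'a :: field_char_0 fps" and N :: 'a
  assumes y: "fps_XD ((1 - fps_X) * fps_XD y) = - fps_const N * fps_X * y"
  defines "w \<equiv> y ^ 2"
  shows "(of_nat n + 2) ^ 3 * w $ (n + 2)
           = (2 * of_nat n + 3) * (- 2 * N + (of_nat n + 1) * (of_nat n + 2)) * w $ (n + 1)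
             + (of_nat n + 1) * (4 * N - of_nat n * (of_nat n + 2)) * w $ n"
    and "w $ 1 = - 2 * N * w $ 0"
proof -
  have "fps_XD (fps_const N) = 0"
    by (simp add: fps_XD_def)
  note eq = square_legendre_equation[OF y this, folded w_def]
  \<comment> \<open>as a single constant series, the factor can be pulled out of each coefficient\<close>
  have two: "- 2 * fps_const N = fps_const (- 2 * N)"
    by (simp add: fps_numeral_fps_const)
  show "(of_nat n + 2) ^ 3 * w $ (n + 2)
           = (2 * of_nat n + 3) * (- 2 * N + (of_nat n + 1) * (of_nat n + 2)) * w $ (n + 1)
             + (of_nat n + 1) * (4 * N - of_nat n * (of_nat n + 2)) * w $ n"
    using arg_cong[OF eq, of "\<lambda>f. f $ Suc (Suc n)"] unfolding two
    by (simp add: fps_mult_one_minus_X_nth_Suc numeral_2_eq_2 del: fps_const_mult fps_const_neg)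
       (simp add: algebra_simps power3_eq_cube)
  show "w $ 1 = - 2 * N * w $ 0"
    using arg_cong[OF eq, of "\<lambda>f. f $ Suc 0"] unfolding two
    by (simp add: fps_mult_one_minus_X_nth_Suc)
qed

theorem corollary2p5:
  fixes m :: nat and z :: complex and u :: "nat \<Rightarrow> complex"
  assumes "norm z < 1"
    and "u 0 = 1"
    and "u 1 = - 2 * of_nat m * (of_nat m + 1)"
    and "\<And>n. n \<ge> 1 \<Longrightarrow>
           u (n + 1) =
             (2 * of_nat n + 1) * (- 2 * of_nat m * (of_nat m + 1) + of_nat n ^ 2 + of_nat n)
               / (of_nat n + 1) ^ 3 * u n
             + ((2 * of_nat m + 1) ^ 2 * of_nat n - of_nat n ^ 3)
               / (of_nat n + 1) ^ 3 * u (n - 1)"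
  shows "(poly (legendre_poly m) (1 - 2 * z)) ^ 2
           = (hypergeo_2F1 (- of_nat m) (of_nat m + 1) 1 z) ^ 2
         \<and> (\<lambda>n. u n * z ^ n) sums (hypergeo_2F1 (- of_nat m) (of_nat m + 1) 1 z) ^ 2"
proof -
  define Q where "Q = pcompose (legendre_poly m) [:1, -2 :: complex:]"
  define w where "w = fps_of_poly Q ^ 2"
  define N :: complex where "N = of_nat m * (of_nat m + 1)"
  have F: "hypergeo_2F1 (- of_nat m) (of_nat m + 1) 1 z = poly Q z"
    by (simp add: hypergeo_2F1_def fps_hypergeo_eq_shifted_legendre Q_def)
  have P: "poly (legendre_poly m) (1 - 2 * z) = poly Q z"
    by (simp add: Q_def poly_pcompose algebra_simps)

  have "- of_nat m * (of_nat m + 1) = - fps_const N"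
    by (simp add: N_def fps_of_nat flip: fps_const_mult fps_const_add)
  then have "fps_XD ((1 - fps_X) * fps_XD (fps_of_poly Q)) = - fps_const N * fps_X * fps_of_poly Q"
    using shifted_legendre_equation[of m, where 'a = complex] by (simp only: Q_def)
  note rec = square_legendre_recurrence[OF this, folded w_def]
  have w0: "w $ 0 = 1"
    by (simp add: w_def Q_def power2_eq_square poly_pcompose poly_legendre_poly_1
        flip: poly_0_coeff_0)

  have "w $ n = u n \<and> w $ (n + 1) = u (n + 1)" for n
  proof (induction n)
    case 0
    then show ?case
      using w0 rec(2) assms(2,3) by (simp add: N_def)
  next
    case (Suc n)
    have nz: "of_nat n + (2 :: complex) \<noteq> 0"
      using of_nat_neq_0[of "Suc n", where 'a = complex] by (simp add: add.commute)
    \<comment> \<open>the given recurrence at index \<open>n + 1\<close>, with its coefficients written in terms of \<open>N\<close>\<close>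
    have coeffs: "2 * of_nat (n + 1) + 1 = 2 * of_nat n + (3 :: complex)"
      "of_nat (n + 1) + 1 = of_nat n + (2 :: complex)"
      "- 2 * of_nat m * (of_nat m + 1) + of_nat (n + 1) ^ 2 + of_nat (n + 1)
         = - 2 * N + (of_nat n + 1) * (of_nat n + 2)"
      "(2 * of_nat m + 1) ^ 2 * of_nat (n + 1) - of_nat (n + 1) ^ 3
         = (of_nat n + 1) * (4 * N - of_nat n * (of_nat n + 2))"
      by (simp_all add: N_def algebra_simps power2_eq_square power3_eq_cube)
    have clear_denominator: "a ^ 3 * x = b * y + c * z"
      if "x = b / a ^ 3 * y + c / a ^ 3 * z" "a \<noteq> 0"
      for a b c x y z :: complex
      using that by (simp add: field_simps)
    have idx: "n + 1 + 1 = n + 2" "n + 1 - 1 = n" "1 \<le> n + 1"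
      by simp_all
    have "(of_nat n + 2) ^ 3 * u (n + 2)
        = (2 * of_nat n + 3) * (- 2 * N + (of_nat n + 1) * (of_nat n + 2)) * u (n + 1)
          + (of_nat n + 1) * (4 * N - of_nat n * (of_nat n + 2)) * u n"
      using assms(4)[OF idx(3)] unfolding coeffs idx by (rule clear_denominator[OF _ nz])
    with rec(1)[of n] Suc.IH have "(of_nat n + 2) ^ 3 * w $ (n + 2) = (of_nat n + 2) ^ 3 * u (n + 2)"
      by simp
    then show ?case
      using nz Suc.IH by simp
  qed
  then have w: "w $ n = u n" for n
    by blast

  have "w = fps_of_poly (Q ^ 2)"
    by (simp add: w_def fps_of_poly_power)
  then have "(\<lambda>n. w $ n * z ^ n) sums poly Q z ^ 2"
    using sums_eval_fps[of z "fps_of_poly (Q ^ 2)"] by (simp del: fps_of_poly_nth)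
  then show ?thesis
    by (simp add: F P w)
qed

end
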